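(* Assume that $c:\mathbb{X}\times\mathbb{U}\to\mathbb{R}$ is non-negative, measurable and bounded. Let $\widetilde\gamma^*\in\Gamma$ be an optimal (or $\varepsilon$-optimal) control policy for the single-stage stochastic control problem with cost function $c$, initial distribution $\widetilde P\in\mathcal{P}(\mathbb{X})$ and measurement channel $Q$. Let $P$ be another probability distribution on $\mathbb{X}$. Then $$|J(P,Q,\widetilde\gamma^* )-J^*(P,Q)|\le2\|c\|_\infty\|P-\widetilde P\|_{TV}.$$
   Context: $\mathbb{X}\subset\mathbb{R}^n$, $\mathbb{Y}\subset\mathbb{R}^m$ and $\mathbb{U}$ (a subset of some Euclidean space) are Borel sets; $\mathcal{P}(\mathbb{X})$ is the set of Borel probability measures on $\mathbb{X}$. A measurement channel $Q$ is a stochastic kernel from $\mathbb{X}$ to $\mathbb{Y}$. $\Gamma$ is the set of Borel measurable functions $\gamma:\mathbb{Y}\to\mathbb{U}$ (policies). Define $$J(P,Q,\gamma)=\int_{\mathbb{X}}\int_{\mathbb{Y}}c(x,\gamma(y))\,Q(dy|x)\,P(dx),\qquad J^*(P,Q)=\inf_{\gamma\in\Gamma}J(P,Q,\gamma).$$ A policy $\gamma$ is optimal for the problem with initial distribution $\widetilde P$ if $J(\widetilde P,Q,\gamma)=J^*(\widetilde P,Q)$, and $\varepsilon$-optimal if $J(\widetilde P,Q,\gamma)\le J^*(\widetilde P,Q)+\varepsilon$. $\|c\|_\infty$ is the supremum norm of $c$, and $\|\mu-\nu\|_{TV}=2\sup_B|\mu(B)-\nu(B)|$ over Borel sets $B$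.
   Formalization: For an ε-optimal policy the bound is proved with an additional +ε on the right-hand side, since without it the claim fails (e.g. c(x,u)=u, U={0,1}, policy constantly 1, ε=1, P close to P̃); for an optimal policy the bound is as stated. *)

theory Defs
  imports "HOL-Probability.Giry_Monad"
begin

abbreviation borel_on :: "'a::topological_space set \<Rightarrow> 'a measure" where
  "borel_on A \<equiv> restrict_space borel A"

text \<open>Measures in \<open>prob_measures X\<close> live on the Borel sigma-algebra of the subspace \<open>X\<close>,
  not on that of the ambient space.\<close>

definition prob_measures :: "'a::topological_space set \<Rightarrow> 'a measure set" where
  "prob_measures X = {P. prob_space P \<and> sets P = sets (borel_on X)}"

definition channels ::
    "'a::topological_space set \<Rightarrow> 'b::topological_space set \<Rightarrow> ('a \<Rightarrow> 'b measure) set" where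
  "channels X Y = borel_on X \<rightarrow>\<^sub>M prob_algebra (borel_on Y)"

text \<open>The values of a policy outside \<open>Y\<close> are unconstrained; they do not affect any cost, as
  \<open>Q x\<close> has underlying space \<open>Y\<close> for \<open>x \<in> X\<close>.\<close>

definition policies ::
    "'b::topological_space set \<Rightarrow> 'u::topological_space set \<Rightarrow> ('b \<Rightarrow> 'u) set" where
  "policies Y U = borel_on Y \<rightarrow>\<^sub>M borel_on U"

definition cost ::
    "('a \<times> 'u \<Rightarrow> real) \<Rightarrow> 'a measure \<Rightarrow> ('a \<Rightarrow> 'b measure) \<Rightarrow> ('b \<Rightarrow> 'u) \<Rightarrow> real" where
  "cost c P Q \<gamma> = (\<integral>x. (\<integral>y. c (x, \<gamma> y) \<partial>Q x) \<partial>P)"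

text \<open>A real-valued infimum: it is the intended one whenever there is a policy and the costs are
  bounded below, e.g. for non-negative \<open>c\<close>.\<close>

definition opt_cost ::
    "'b::topological_space set \<Rightarrow> 'u::topological_space set \<Rightarrow> ('a \<times> 'u \<Rightarrow> real)
      \<Rightarrow> 'a measure \<Rightarrow> ('a \<Rightarrow> 'b measure) \<Rightarrow> real" where
  "opt_cost Y U c P Q = (INF \<gamma>\<in>policies Y U. cost c P Q \<gamma>)"

definition optimal_policy ::
    "'b::topological_space set \<Rightarrow> 'u::topological_space set \<Rightarrow> ('a \<times> 'u \<Rightarrow> real)
      \<Rightarrow> 'a measure \<Rightarrow> ('a \<Rightarrow> 'b measure) \<Rightarrow> ('b \<Rightarrow> 'u) \<Rightarrow> bool" where
  "optimal_policy Y U c P Q \<gamma> \<longleftrightarrow>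
     \<gamma> \<in> policies Y U \<and> cost c P Q \<gamma> = opt_cost Y U c P Q"

definition eps_optimal_policy ::
    "real \<Rightarrow> 'b::topological_space set \<Rightarrow> 'u::topological_space set \<Rightarrow> ('a \<times> 'u \<Rightarrow> real)
      \<Rightarrow> 'a measure \<Rightarrow> ('a \<Rightarrow> 'b measure) \<Rightarrow> ('b \<Rightarrow> 'u) \<Rightarrow> bool" where
  "eps_optimal_policy \<epsilon> Y U c P Q \<gamma> \<longleftrightarrow>
     \<gamma> \<in> policies Y U \<and> cost c P Q \<gamma> \<le> opt_cost Y U c P Q + \<epsilon>"

definition sup_norm_on :: "'a set \<Rightarrow> ('a \<Rightarrow> real) \<Rightarrow> real" where
  "sup_norm_on S f = (SUP z\<in>S. \<bar>f z\<bar>)"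

text \<open>With the factor 2, values range over \<open>[0, 2]\<close> on probability measures. Both arguments are
  meant to have the same measurable sets.\<close>

definition tv_dist :: "'a measure \<Rightarrow> 'a measure \<Rightarrow> real" where
  "tv_dist \<mu> \<nu> = 2 * (SUP B\<in>sets \<mu>. \<bar>measure \<mu> B - measure \<nu> B\<bar>)"

end

theory Submission
  imports Defs
begin

text \<open>For a bounded measurable function \<open>f\<close> with values in \<open>[0, C]\<close>, splitting the space along a
  Hahn decomposition of \<open>\<mu> - \<nu>\<close> bounds the difference of its integrals by half of \<open>C\<close> times the
  total variation distance. Applied to the cost of a fixed policy as a function of the state, this
  shows that changing the initial distribution changes the cost of every policy by at most a fixed
  amount. A near-minimiser for one distribution is then a near-minimiser for the other, with twice
  that amount lost.\<close>

text \<open>The domination is assumed only on subsets of \<open>A\<close>, which is what each half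
  of a Hahn decomposition provides. Restricting both measures to \<open>A\<close> turns it into an
  inequality of measures, and the nonnegative integral is monotone in the measure.\<close>

lemma set_integral_mono_measure:
  fixes f :: "'a \<Rightarrow> real"
  assumes sets: "sets N = sets M" and A: "A \<in> sets M"
    and le: "\<And>B. B \<in> sets M \<Longrightarrow> B \<subseteq> A \<Longrightarrow> emeasure M B \<le> emeasure N B"
    and f: "f \<in> borel_measurable M" and nonneg: "\<And>x. x \<in> space M \<Longrightarrow> 0 \<le> f x"
    and int: "integrable N f"
  shows "(\<integral>x. indicator A x * f x \<partial>M) \<le> (\<integral>x. indicator A x * f x \<partial>N)"
proof -
  have sp: "space N = space M"
    using sets by (rule sets_eq_imp_space_eq)
  have AN: "A \<in> sets N" and fN: "f \<in> borel_measurable N"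
    using A int sets by auto
  \<comment> \<open>Once spaces and measurable sets agree, the order on measures compares
    \<open>emeasure\<close> on all sets; on non-measurable ones both values are 0.\<close>
  have le': "restrict_space M A \<le> restrict_space N A"
  proof -
    have "emeasure (restrict_space M A) B \<le> emeasure (restrict_space N A) B" for B
    proof (cases "B \<in> sets (restrict_space M A)")
      case True
      then show ?thesis
        using A AN le sets by (auto simp: sets_restrict_space_iff emeasure_restrict_space)
    next
      case False
      then show ?thesis
        by (simp add: emeasure_notin_sets)
    qed
    then show ?thesis
      by (simp add: le_measure_iff space_restrict_space sets_restrict_space le_fun_def sets sp)
  qed
  have "(\<integral>\<^sup>+x. ennreal (indicator A x * f x) \<partial>M) = (\<integral>\<^sup>+x. ennreal (f x) \<partial>restrict_space M A)"
    using A by (subst nn_integral_restrict_space) (auto intro!: nn_integral_cong split: split_indicator)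
  also have "\<dots> \<le> (\<integral>\<^sup>+x. ennreal (f x) \<partial>restrict_space N A)"
    using le' by (intro nn_integral_mono_measure) (auto simp: sets_restrict_space sets)
  also have "\<dots> = (\<integral>\<^sup>+x. ennreal (indicator A x * f x) \<partial>N)"
    using AN by (subst nn_integral_restrict_space) (auto intro!: nn_integral_cong split: split_indicator)
  finally have nn: "(\<integral>\<^sup>+x. ennreal (indicator A x * f x) \<partial>M) \<le> (\<integral>\<^sup>+x. ennreal (indicator A x * f x) \<partial>N)" .
  have intN: "integrable N (\<lambda>x. indicator A x * f x)"
    using integrable_mult_indicator[OF AN int] by simp
  \<comment> \<open>Finiteness of the larger side is essential: \<open>enn2real\<close> sends
    infinity to 0 and is monotone only below a finite bound.\<close>
  have "(\<integral>\<^sup>+x. ennreal (indicator A x * f x) \<partial>N) < \<infinity>"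
    using intN nonneg sp by (auto simp: real_integrable_def less_top)
  then show ?thesis
    using nn A f AN fN nonneg sp
    by (subst (1 2) integral_eq_nn_integral) (auto intro!: enn2real_mono)
qed

lemma measure_diff_le_tv_dist:
  assumes "prob_space M" and "prob_space N" and "A \<in> sets M"
  shows "2 * \<bar>measure M A - measure N A\<bar> \<le> tv_dist M N"
proof -
  \<comment> \<open>This bound makes the real-valued \<open>SUP\<close> in \<open>tv_dist\<close> a
    genuine upper bound.\<close>
  have "\<bar>measure M B - measure N B\<bar> \<le> 1" for B
    using prob_space.prob_le_1[OF assms(1), of B] prob_space.prob_le_1[OF assms(2), of B]
      measure_nonneg[of M B] measure_nonneg[of N B] by linarith
  then show ?thesis
    unfolding tv_dist_def using assms(3) by (auto intro!: cSUP_upper bdd_aboveI2)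
qed

lemma tv_dist_nonneg:
  assumes "prob_space M" and "prob_space N"
  shows "0 \<le> tv_dist M N"
  using measure_diff_le_tv_dist[OF assms, of "{}"] by simp

lemma tv_dist_commute:
  assumes "sets N = sets M"
  shows "tv_dist M N = tv_dist N M"
  by (simp add: tv_dist_def assms abs_minus_commute)

text \<open>Among functions with values in [0, C], the difference of integrals is largest for C
  times the indicator of a set \<open>A\<close> on which \<open>M\<close> dominates
  \<open>N\<close>. Using \<open>0 \<le> f\<close> as well as \<open>f \<le> C\<close> gains a
  factor 2 over the estimate for functions with absolute value at most C.\<close>

lemma integral_diff_le_tv_dist:
  fixes f :: "'a \<Rightarrow> real"
  assumes M: "prob_space M" and N: "prob_space N" and sets: "sets N = sets M"
    and f: "f \<in> borel_measurable M" and f_bounds: "\<And>x. x \<in> space M \<Longrightarrow> 0 \<le> f x \<and> f x \<le> C"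
  shows "2 * ((\<integral>x. f x \<partial>M) - (\<integral>x. f x \<partial>N)) \<le> C * tv_dist M N"
proof -
  interpret M: prob_space M by fact
  interpret N: prob_space N by fact
  have sp: "space N = space M"
    using sets by (rule sets_eq_imp_space_eq)
  \<comment> \<open>A probability space has a point, and the bounds on \<open>f\<close> there force
    C to be nonnegative.\<close>
  obtain x where "x \<in> space M"
    using M.not_empty by blast
  then have "0 \<le> C"
    using f_bounds by force
  have fN: "f \<in> borel_measurable N"
    using f sets by auto
  obtain A where A: "A \<in> sets M"
    and inside: "\<And>B. B \<in> sets M \<Longrightarrow> B \<subseteq> A \<Longrightarrow> emeasure N B \<le> emeasure M B"
    and outside: "\<And>B. B \<in> sets M \<Longrightarrow> B \<inter> A = {} \<Longrightarrow> emeasure M B \<le> emeasure N B"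
    using finite_unsigned_Hahn_decomposition[OF M.finite_measure_axioms N.finite_measure_axioms sets]
    by metis
  define D where "D = space M - A"
  have D: "D \<in> sets M" and AN: "A \<in> sets N" "D \<in> sets N"
    using A sets by (auto simp: D_def)
  have intM: "integrable M f"
    using f f_bounds by (intro M.integrable_const_bound[of _ C]) auto
  have intN: "integrable N f"
    using fN f_bounds sp by (intro N.integrable_const_bound[of _ C]) auto
  have on_D: "(\<integral>x. indicator D x * f x \<partial>M) \<le> (\<integral>x. indicator D x * f x \<partial>N)"
    using sets D f f_bounds intN outside
    by (intro set_integral_mono_measure) (auto simp: D_def)
  \<comment> \<open>Here the measures swap roles, and the nonnegative integrand is the gap between
    \<open>f\<close> and C.\<close>
  have on_A: "(\<integral>x. indicator A x * (C - f x) \<partial>N) \<le> (\<integral>x. indicator A x * (C - f x) \<partial>M)"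
    using sets AN fN f_bounds intM inside sp
    by (intro set_integral_mono_measure) auto
  \<comment> \<open>This compares \<open>f\<close> with the extremal function: it falls short by
    \<open>C - f\<close> on \<open>A\<close> and exceeds it by \<open>f\<close> on
    \<open>D\<close>.\<close>
  have decomp: "(\<integral>x. f x \<partial>L) = C * measure L A - (\<integral>x. indicator A x * (C - f x) \<partial>L)
      + (\<integral>x. indicator D x * f x \<partial>L)"
    if L: "prob_space L" "sets L = sets M" "integrable L f" for L
  proof -
    interpret L: prob_space L by fact
    have spL: "space L = space M"
      using L(2) by (rule sets_eq_imp_space_eq)
    have AL: "A \<in> sets L" "D \<in> sets L"
      using A D L(2) by auto
    have i1: "integrable L (\<lambda>x. indicator A x * (C - f x))"
      using integrable_mult_indicator[OF AL(1), of "\<lambda>x. C - f x"] L(3) by simp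
    have i2: "integrable L (\<lambda>x. indicator D x * f x)"
      using integrable_mult_indicator[OF AL(2) L(3)] by simp
    have i3: "integrable L (\<lambda>x. C * indicator A x)"
      using AL by (simp add: integrable_indicator_iff less_top[symmetric])
    have "(\<integral>x. f x \<partial>L) = (\<integral>x. C * indicator A x - indicator A x * (C - f x) + indicator D x * f x \<partial>L)"
      using spL by (intro Bochner_Integration.integral_cong) (auto simp: D_def split: split_indicator)
    also have "\<dots> = (\<integral>x. C * indicator A x \<partial>L) - (\<integral>x. indicator A x * (C - f x) \<partial>L)
      + (\<integral>x. indicator D x * f x \<partial>L)"
      using i1 i2 i3 by simp
    finally show ?thesis
      using AL by simp
  qed
  \<comment> \<open>After subtracting the two decompositions, \<open>on_A\<close> and
    \<open>on_D\<close> say that both corrections contribute at most 0.\<close>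
  have "(\<integral>x. f x \<partial>M) - (\<integral>x. f x \<partial>N) \<le> C * (measure M A - measure N A)"
    using decomp[OF M refl intM] decomp[OF N sets intN] on_D on_A by (simp add: algebra_simps)
  moreover have "C * (2 * (measure M A - measure N A)) \<le> C * tv_dist M N"
  proof (rule mult_left_mono)
    have "2 * (measure M A - measure N A) \<le> 2 * \<bar>measure M A - measure N A\<bar>"
      by (intro mult_left_mono abs_ge_self) simp
    also have "\<dots> \<le> tv_dist M N"
      by (rule measure_diff_le_tv_dist[OF M N A])
    finally show "2 * (measure M A - measure N A) \<le> tv_dist M N" .
  qed fact
  ultimately show ?thesis
    by (simp add: algebra_simps)
qed

lemma space_borel_on [simp]: "space (borel_on A) = A"
  by (simp add: space_restrict_space)

lemma channel_prob_space:
  assumes "Q \<in> channels X Y" and "x \<in> X"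
  shows "prob_space (Q x)" and "sets (Q x) = sets (borel_on Y)"
  using measurable_space[of Q "borel_on X" "prob_algebra (borel_on Y)" x] assms
  by (auto simp: channels_def space_prob_algebra)

text \<open>Since \<open>c\<close> is measurable only on the trace of \<open>X \<times> U\<close>,
  the inner map is first shown measurable into the ambient product, using second countability, and
  then seen to land in \<open>X \<times> U\<close>.\<close>

lemma measurable_cost_integrand:
  fixes X :: "'a::second_countable_topology set" and U :: "'u::second_countable_topology set"
    and c :: "'a \<times> 'u \<Rightarrow> real"
  assumes c: "c \<in> borel_measurable (borel_on (X \<times> U))" and g: "g \<in> policies Y U"
  shows "(\<lambda>(x, y). c (x, g y)) \<in> borel_measurable (borel_on X \<Otimes>\<^sub>M borel_on Y)"
proof -
  have g': "g \<in> borel_on Y \<rightarrow>\<^sub>M borel_on U"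
    using g by (simp add: policies_def)
  have X: "fst \<in> borel_on X \<Otimes>\<^sub>M borel_on Y \<rightarrow>\<^sub>M borel"
    by (rule measurable_compose[OF measurable_fst]) (simp add: measurable_restrict_space1)
  have U: "(\<lambda>p. g (snd p)) \<in> borel_on X \<Otimes>\<^sub>M borel_on Y \<rightarrow>\<^sub>M borel"
    using g' by (intro measurable_compose[OF measurable_snd]) (simp add: measurable_restrict_space2_iff)
  have "(\<lambda>p. (fst p, g (snd p))) \<in> borel_on X \<Otimes>\<^sub>M borel_on Y \<rightarrow>\<^sub>M borel_on (X \<times> U)"
    using borel_measurable_Pair[OF X U] measurable_space[OF g']
    by (intro measurable_restrict_space2) (auto simp: space_pair_measure)
  from measurable_compose[OF this c] show ?thesis
    by (simp add: case_prod_unfold)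
qed

text \<open>The inner integral is a measurable function of the state with values in [0, C], so the
  total variation estimate applies to it.\<close>

lemma conditional_cost:
  fixes X :: "'a::second_countable_topology set" and U :: "'u::second_countable_topology set"
    and c :: "'a \<times> 'u \<Rightarrow> real"
  assumes c: "c \<in> borel_measurable (borel_on (X \<times> U))" and g: "g \<in> policies Y U"
    and Q: "Q \<in> channels X Y"
    and bounds: "\<And>x u. x \<in> X \<Longrightarrow> u \<in> U \<Longrightarrow> 0 \<le> c (x, u) \<and> c (x, u) \<le> C"
  shows measurable_conditional_cost:
      "(\<lambda>x. \<integral>y. c (x, g y) \<partial>Q x) \<in> borel_measurable (borel_on X)"
    and conditional_cost_bounds:
      "x \<in> X \<Longrightarrow> 0 \<le> (\<integral>y. c (x, g y) \<partial>Q x) \<and> (\<integral>y. c (x, g y) \<partial>Q x) \<le> C"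
proof -
  have gU: "g y \<in> U" if "y \<in> Y" for y
    using measurable_space[of g "borel_on Y" "borel_on U"] g that by (simp add: policies_def)
  note meas = measurable_cost_integrand[OF c g]
  have fib: "(\<lambda>y. c (x, g y)) \<in> borel_measurable (Q x)" and sp: "space (Q x) = Y" if "x \<in> X" for x
    using measurable_Pair2[OF meas, of x] that channel_prob_space(2)[OF Q that]
      sets_eq_imp_space_eq[OF channel_prob_space(2)[OF Q that]]
    by (auto cong: measurable_cong_sets)
  \<comment> \<open>Measurability in the kernel's parameter comes from the nonnegative integral,
    which agrees with the Bochner integral on \<open>X\<close> because \<open>c\<close> is
    nonnegative there.\<close>
  have "(\<lambda>x. enn2real (\<integral>\<^sup>+y. ennreal (c (x, g y)) \<partial>Q x)) \<in> borel_measurable (borel_on X)"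
    using Q meas
    by (intro borel_measurable_enn2real nn_integral_measurable_subprob_algebra2[where N = "borel_on Y"])
      (auto simp: channels_def case_prod_unfold intro: measurable_prob_algebraD)
  moreover have "(\<integral>y. c (x, g y) \<partial>Q x) = enn2real (\<integral>\<^sup>+y. ennreal (c (x, g y)) \<partial>Q x)"
    if "x \<in> X" for x
    using fib[OF that] sp[OF that] gU bounds that by (intro integral_eq_nn_integral) auto
  ultimately show "(\<lambda>x. \<integral>y. c (x, g y) \<partial>Q x) \<in> borel_measurable (borel_on X)"
    by (subst measurable_cong) auto
  show "0 \<le> (\<integral>y. c (x, g y) \<partial>Q x) \<and> (\<integral>y. c (x, g y) \<partial>Q x) \<le> C" if x: "x \<in> X"
  proof -
    interpret prob_space "Q x"
      by (rule channel_prob_space(1)[OF Q x])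
    have *: "AE y in Q x. 0 \<le> c (x, g y)" "AE y in Q x. c (x, g y) \<le> C"
      using sp[OF x] gU bounds x by auto
    moreover have "integrable (Q x) (\<lambda>y. c (x, g y))"
      using fib[OF x] sp[OF x] gU bounds x by (intro integrable_const_bound[of _ C]) auto
    ultimately show ?thesis
      using integral_ge_const integral_le_const by blast
  qed
qed

text \<open>Each change of initial distribution costs only half of C times the distance, so two
  changes together cost C times the distance.\<close>

lemma cost_diff_le_tv_dist:
  fixes X :: "'a::second_countable_topology set" and U :: "'u::second_countable_topology set"
    and c :: "'a \<times> 'u \<Rightarrow> real"
  assumes c: "c \<in> borel_measurable (borel_on (X \<times> U))" and g: "g \<in> policies Y U"
    and Q: "Q \<in> channels X Y"
    and bounds: "\<And>x u. x \<in> X \<Longrightarrow> u \<in> U \<Longrightarrow> 0 \<le> c (x, u) \<and> c (x, u) \<le> C"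
    and M: "M \<in> prob_measures X" and N: "N \<in> prob_measures X"
  shows "2 * (cost c M Q g - cost c N Q g) \<le> C * tv_dist M N"
proof -
  have M': "prob_space M" "sets M = sets (borel_on X)" "space M = X"
    using M sets_eq_imp_space_eq[of M "borel_on X"] by (auto simp: prob_measures_def)
  have N': "prob_space N" "sets N = sets (borel_on X)"
    using N by (auto simp: prob_measures_def)
  show ?thesis
    unfolding cost_def
    using M' N' measurable_conditional_cost[OF c g Q bounds] conditional_cost_bounds[OF c g Q bounds]
    by (intro integral_diff_le_tv_dist) (auto cong: measurable_cong_sets)
qed

lemma eps_optimal_policy_robust:
  fixes X :: "'a::second_countable_topology set" and U :: "'u::second_countable_topology set"
    and c :: "'a \<times> 'u \<Rightarrow> real"
  assumes c: "c \<in> borel_measurable (borel_on (X \<times> U))" and Q: "Q \<in> channels X Y"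
    and bounds: "\<And>x u. x \<in> X \<Longrightarrow> u \<in> U \<Longrightarrow> 0 \<le> c (x, u) \<and> c (x, u) \<le> C"
    and P: "P \<in> prob_measures X" and Pt: "Pt \<in> prob_measures X"
    and opt: "eps_optimal_policy \<epsilon> Y U c Pt Q \<gamma>"
  shows "\<bar>cost c P Q \<gamma> - opt_cost Y U c P Q\<bar> \<le> C * tv_dist P Pt + \<epsilon>"
proof -
  have \<gamma>: "\<gamma> \<in> policies Y U" and opt': "cost c Pt Q \<gamma> \<le> opt_cost Y U c Pt Q + \<epsilon>"
    using opt by (auto simp: eps_optimal_policy_def)
  \<comment> \<open>Nonnegative costs are bounded below, so the real-valued \<open>INF\<close> is a
    genuine lower bound.\<close>
  have lower: "opt_cost Y U c M Q \<le> cost c M Q g"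
    if M: "M \<in> prob_measures X" and g: "g \<in> policies Y U" for M g
  proof -
    have "space M = X"
      using M sets_eq_imp_space_eq[of M "borel_on X"] by (auto simp: prob_measures_def)
    then have "0 \<le> cost c M Q h" if "h \<in> policies Y U" for h
      unfolding cost_def using conditional_cost_bounds[OF c that Q bounds]
      by - (rule Bochner_Integration.integral_nonneg, simp)
    then show ?thesis
      unfolding opt_cost_def using g by (intro cINF_lower bdd_belowI2[where m = 0]) auto
  qed
  have "sets P = sets Pt"
    using P Pt by (simp add: prob_measures_def)
  then have comm: "tv_dist Pt P = tv_dist P Pt"
    by (rule tv_dist_commute)
  have "cost c P Q \<gamma> - C * tv_dist P Pt - \<epsilon> \<le> opt_cost Y U c P Q"
    unfolding opt_cost_def
  proof (rule cINF_greatest)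
    show "policies Y U \<noteq> {}"
      using \<gamma> by blast
    \<comment> \<open>Pass from \<open>P\<close> to \<open>Pt\<close> with \<gamma>, replace
      \<gamma> by \<open>g\<close> using near-optimality at \<open>Pt\<close>, and return to
      \<open>P\<close> with \<open>g\<close>. Allowing every \<open>g\<close> avoids choosing a
      near-minimiser for \<open>P\<close>.\<close>
    show "cost c P Q \<gamma> - C * tv_dist P Pt - \<epsilon> \<le> cost c P Q g" if g: "g \<in> policies Y U" for g
      using cost_diff_le_tv_dist[OF c \<gamma> Q bounds P Pt] cost_diff_le_tv_dist[OF c g Q bounds Pt P]
        lower[OF Pt g] opt' comm by simp
  qed
  then show ?thesis
    using lower[OF P \<gamma>] by simp
qed

lemma le_sup_norm_on:
  assumes "bounded (f ` S)" and "z \<in> S"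
  shows "\<bar>f z\<bar> \<le> sup_norm_on S f"
proof -
  obtain B where "\<And>w. w \<in> S \<Longrightarrow> \<bar>f w\<bar> \<le> B"
    using assms(1) by (auto simp: bounded_real)
  then show ?thesis
    unfolding sup_norm_on_def using assms(2) by (intro cSUP_upper bdd_aboveI2) auto
qed

theorem proposition3p1:
  fixes X :: "(real ^ 'n) set" and Y :: "(real ^ 'm) set" and U :: "'u::euclidean_space set"
    and c :: "(real ^ 'n) \<times> 'u \<Rightarrow> real"
    and P Pt :: "(real ^ 'n) measure"
    and Q :: "real ^ 'n \<Rightarrow> (real ^ 'm) measure"
    and \<gamma> :: "real ^ 'm \<Rightarrow> 'u"
  assumes "X \<in> sets borel" and "Y \<in> sets borel" and "U \<in> sets borel"
    and "\<And>x u. x \<in> X \<Longrightarrow> u \<in> U \<Longrightarrow> 0 \<le> c (x, u)"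
    and "c \<in> borel_measurable (borel_on (X \<times> U))"
    and "bounded (c ` (X \<times> U))"
    and "Q \<in> channels X Y"
    and "Pt \<in> prob_measures X" and "P \<in> prob_measures X"
  shows "(optimal_policy Y U c Pt Q \<gamma> \<longrightarrow>
            \<bar>cost c P Q \<gamma> - opt_cost Y U c P Q\<bar>
              \<le> 2 * sup_norm_on (X \<times> U) c * tv_dist P Pt) \<and>
         (\<forall>\<epsilon>>0. eps_optimal_policy \<epsilon> Y U c Pt Q \<gamma> \<longrightarrow>
            \<bar>cost c P Q \<gamma> - opt_cost Y U c P Q\<bar>
              \<le> 2 * sup_norm_on (X \<times> U) c * tv_dist P Pt + \<epsilon>)"
proof -
  let ?C = "sup_norm_on (X \<times> U) c"
  have bounds: "0 \<le> c (x, u) \<and> c (x, u) \<le> ?C" if "x \<in> X" "u \<in> U" for x u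
    using le_sup_norm_on[OF assms(6), of "(x, u)"] assms(4) that by fastforce
  \<comment> \<open>No sign is imposed on \<epsilon>, so the value 0 covers optimal policies. The
    previous estimate has constant 1 in place of 2; the weaker form needs only that
    \<open>?C * tv_dist P Pt\<close> is nonnegative.\<close>
  have key: "\<bar>cost c P Q \<gamma> - opt_cost Y U c P Q\<bar> \<le> 2 * ?C * tv_dist P Pt + \<epsilon>"
    if opt: "eps_optimal_policy \<epsilon> Y U c Pt Q \<gamma>" for \<epsilon>
  proof -
    have "prob_space P" "prob_space Pt" "space P = X"
      using assms(8,9) sets_eq_imp_space_eq[of P "borel_on X"] by (auto simp: prob_measures_def)
    moreover from this obtain x where x: "x \<in> X"
      using prob_space.not_empty by blast
    \<comment> \<open>The conditional cost at a point of \<open>X\<close> lies between 0 and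
      \<open>?C\<close>, which gives the sign without exhibiting a point of
      \<open>U\<close>.\<close>
    moreover have "0 \<le> ?C"
      using conditional_cost_bounds[OF assms(5) _ assms(7) bounds x, of \<gamma>] opt
      by (auto simp: eps_optimal_policy_def)
    ultimately have "0 \<le> ?C * tv_dist P Pt"
      by (simp add: tv_dist_nonneg)
    then show ?thesis
      using eps_optimal_policy_robust[OF assms(5,7) bounds assms(9,8) opt] by simp
  qed
  moreover have "eps_optimal_policy 0 Y U c Pt Q \<gamma>" if "optimal_policy Y U c Pt Q \<gamma>"
    using that by (simp add: optimal_policy_def eps_optimal_policy_def)
  ultimately show ?thesis
    by fastforce
qed

end
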